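(* (a) If there is a polynomial-time algorithm for the two-item aperiodic joint replenishment problem, then there is a polynomial-time algorithm for integer factorization. (b) If there is a polynomial-time algorithm for the two-item periodic joint replenishment problem, then there is a polynomial-time algorithm for integer factorization.
   Context: For $K \ge 0$, $H \ge 0$ and a positive integer $q$, the EOQ cost is $c(q;K,H) = K/q + Hq$. Two-item aperiodic joint replenishment problem. - Input: rationals $K_0, K_1, K_2, H_1, H_2 \ge 0$ with $K_0 \le K_1$ and $K_0 \le K_2$. - Task: find positive integers $q_1, q_2$ minimizing $$c(q_1;K_1,H_1) + c(q_2;K_2,H_2) - \frac{K_0}{\mathrm{lcm}(q_1,q_2)}.$$ Two-item periodic joint replenishment problem. - Input: rationals $K_0, K_1, K_2, H_1, H_2 \ge 0$. - Task: find positive integers $q_1, q_2$ minimizing $$c(q_1;K_1,H_1) + c(q_2;K_2,H_2) + \frac{K_0}{\gcd(q_1,q_2)}.$$ In both problems, "polynomial-time" means polynomial in the bit size of the input coefficients. Integer factorization: given a positive integer $M$ (encoded in binary), output its prime factorization. Polynomial time here means polynomial in $\log M$. *)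

theory Defs
  imports
    "HOL-Library.Log_Nat"
    "HOL-Computational_Algebra.Primes"
    "HOL-Computational_Algebra.Polynomial"
begin

section \<open>Model of computation\<close>

text \<open>
  Algorithms are structured programs over finitely many stacks of natural numbers, with running
  time measured by the logarithmic cost criterion: every operation is charged the binary lengths
  of the numbers it handles. With these charges all numbers and stacks arising in a run have total
  binary length at most linear in the running time plus the input length, and every operation is
  computable in time polynomial in its charge; conversely, the two halves of a Turing machine
  tape are two stacks of symbols. The model is hence polynomially equivalent to Turing machines.
\<close>

definition bits :: "nat \<Rightarrow> nat" where
  "bits n = Suc (floorlog 2 n)"

definition bits_list :: "nat list \<Rightarrow> nat" where
  "bits_list xs = (\<Sum>x\<leftarrow>xs. bits x)"

type_synonym store = "nat \<Rightarrow> nat list"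

datatype aexp =
    Const nat
  | Top nat
  | NonEmpty nat
  | Add aexp aexp
  | Sub aexp aexp
  | Mult aexp aexp
  | Div aexp aexp

text \<open>Subtraction is truncated and division is integer division, with \<open>n div 0 = 0\<close>.\<close>

definition top_of :: "nat list \<Rightarrow> nat" where
  "top_of xs = (case xs of [] \<Rightarrow> 0 | x # _ \<Rightarrow> x)"

primrec aval :: "aexp \<Rightarrow> store \<Rightarrow> nat" where
  "aval (Const n) s = n"
| "aval (Top x) s = top_of (s x)"
| "aval (NonEmpty x) s = (if s x = [] then 0 else 1)"
| "aval (Add a b) s = aval a s + aval b s"
| "aval (Sub a b) s = aval a s - aval b s"
| "aval (Mult a b) s = aval a s * aval b s"
| "aval (Div a b) s = aval a s div aval b s"

primrec acost :: "aexp \<Rightarrow> store \<Rightarrow> nat" where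
  "acost (Const n) s = bits n"
| "acost (Top x) s = bits (top_of (s x))"
| "acost (NonEmpty x) s = 1"
| "acost (Add a b) s = acost a s + acost b s + bits (aval a s) + bits (aval b s)"
| "acost (Sub a b) s = acost a s + acost b s + bits (aval a s) + bits (aval b s)"
| "acost (Mult a b) s = acost a s + acost b s + bits (aval a s) + bits (aval b s)"
| "acost (Div a b) s = acost a s + acost b s + bits (aval a s) + bits (aval b s)"

datatype com =
    Skip
  | Push nat aexp
  | Pop nat
  | Assign nat aexp
  | Seq com com
  | If aexp com com
  | While aexp com

text \<open>
  \<open>exec c s t s'\<close>: started in \<open>s\<close>, the program \<open>c\<close> halts in \<open>s'\<close> with total cost \<open>t\<close>. A guard
  holds if its value is nonzero. \<open>Assign\<close> overwrites the top of a stack (and acts as \<open>Push\<close> on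
  an empty one).
\<close>

inductive exec :: "com \<Rightarrow> store \<Rightarrow> nat \<Rightarrow> store \<Rightarrow> bool" where
  Skip: "exec Skip s 1 s"
| Push: "exec (Push x a) s (1 + acost a s) (s(x := aval a s # s x))"
| Pop: "exec (Pop x) s (1 + bits (top_of (s x))) (s(x := tl (s x)))"
| Assign: "exec (Assign x a) s (1 + acost a s + bits (top_of (s x)))
    (s(x := aval a s # tl (s x)))"
| Seq: "exec c1 s1 t1 s2 \<Longrightarrow> exec c2 s2 t2 s3 \<Longrightarrow> exec (Seq c1 c2) s1 (t1 + t2) s3"
| IfTrue: "aval a s \<noteq> 0 \<Longrightarrow> exec c1 s t s' \<Longrightarrow> exec (If a c1 c2) s (1 + acost a s + t) s'"
| IfFalse: "aval a s = 0 \<Longrightarrow> exec c2 s t s' \<Longrightarrow> exec (If a c1 c2) s (1 + acost a s + t) s'"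
| WhileFalse: "aval a s = 0 \<Longrightarrow> exec (While a c) s (1 + acost a s) s"
| WhileTrue: "aval a s1 \<noteq> 0 \<Longrightarrow> exec c s1 t1 s2 \<Longrightarrow> exec (While a c) s2 t2 s3
    \<Longrightarrow> exec (While a c) s1 (1 + acost a s1 + t1 + t2) s3"

inductive_cases SkipE: "exec Skip s t s'"
inductive_cases PushE: "exec (Push x a) s t s'"
inductive_cases PopE: "exec (Pop x) s t s'"
inductive_cases AssignE: "exec (Assign x a) s t s'"
inductive_cases SeqE: "exec (Seq c1 c2) s t s'"
inductive_cases IfE: "exec (If a c1 c2) s t s'"
inductive_cases WhileE: "exec (While a c) s t s'"

lemma exec_deterministic:
  "exec c s t s' \<Longrightarrow> exec c s u s'' \<Longrightarrow> u = t \<and> s'' = s'"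
proof (induction arbitrary: u s'' rule: exec.induct)
  case (Skip s)
  then show ?case by (rule SkipE) simp
next
  case (Push x a s)
  then show ?case by (rule PushE) simp
next
  case (Pop x s)
  then show ?case by (rule PopE) simp
next
  case (Assign x a s)
  then show ?case by (rule AssignE) simp
next
  case (Seq c1 s1 t1 s2 c2 t2 s3)
  from Seq.prems obtain v1 r v2 where
    "exec c1 s1 v1 r" "exec c2 r v2 s''" "u = v1 + v2"
    by (rule SeqE)
  with Seq.IH show ?case by metis
next
  case (IfTrue a s c1 t s' c2)
  from IfTrue.prems obtain v where "exec c1 s v s''" "u = 1 + acost a s + v"
    by (rule IfE) (use IfTrue.hyps in simp_all)
  with IfTrue.IH show ?case by metis
next
  case (IfFalse a s c2 t s' c1)
  from IfFalse.prems obtain v where "exec c2 s v s''" "u = 1 + acost a s + v"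
    by (rule IfE) (use IfFalse.hyps in simp_all)
  with IfFalse.IH show ?case by metis
next
  case (WhileFalse a s c)
  from WhileFalse.prems show ?case by (rule WhileE) (use WhileFalse.hyps in simp_all)
next
  case (WhileTrue a s1 c t1 s2 t2 s3)
  from WhileTrue.prems obtain v1 r v2 where
    "exec c s1 v1 r" "exec (While a c) r v2 s''" "u = 1 + acost a s1 + v1 + v2"
    by (rule WhileE) (use WhileTrue.hyps in simp_all)
  with WhileTrue.IH show ?case by metis
qed

text \<open>The input is supplied on stack 0, first entry on top; the output is the final stack 0.\<close>

definition init_store :: "nat list \<Rightarrow> store" where
  "init_store xs = (\<lambda>_. [])(0 := xs)"

text \<open>
  A search problem consists of a set \<open>I\<close> of instances and a relation \<open>R\<close> between instances and
  their solutions, together with encodings of both as lists of numbers. An algorithm has to return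
  some solution, within the time bound, for every instance that has one; nothing is demanded on
  instances without a solution.
\<close>

definition poly_time_solvable ::
  "('a \<Rightarrow> nat list) \<Rightarrow> ('b \<Rightarrow> nat list) \<Rightarrow> 'a set \<Rightarrow> ('a \<Rightarrow> 'b \<Rightarrow> bool) \<Rightarrow> bool" where
  "poly_time_solvable enc_in enc_out I R \<longleftrightarrow>
     (\<exists>(c :: com) (p :: nat poly). \<forall>x\<in>I. (\<exists>y. R x y) \<longrightarrow>
        (\<exists>t s y. exec c (init_store (enc_in x)) t s
               \<and> t \<le> poly p (bits_list (enc_in x))
               \<and> s 0 = enc_out y \<and> R x y))"

section \<open>Joint replenishment with two items\<close>

record jrp =
  K0 :: rat
  K1 :: rat
  K2 :: rat
  H1 :: rat
  H2 :: rat

text \<open>Nonnegative rationals are given by numerator and denominator in lowest terms.\<close>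

definition encode_rat :: "rat \<Rightarrow> nat list" where
  "encode_rat r = (case quotient_of r of (a, b) \<Rightarrow> [nat a, nat b])"

definition encode_jrp :: "jrp \<Rightarrow> nat list" where
  "encode_jrp J = concat (map encode_rat [K0 J, K1 J, K2 J, H1 J, H2 J])"

definition encode_pair :: "nat \<times> nat \<Rightarrow> nat list" where
  "encode_pair = (\<lambda>(q1, q2). [q1, q2])"

definition eoq_cost :: "nat \<Rightarrow> rat \<Rightarrow> rat \<Rightarrow> rat" where
  "eoq_cost q K H = K / of_nat q + H * of_nat q"

definition nonneg_jrp :: "jrp \<Rightarrow> bool" where
  "nonneg_jrp J \<longleftrightarrow> 0 \<le> K0 J \<and> 0 \<le> K1 J \<and> 0 \<le> K2 J \<and> 0 \<le> H1 J \<and> 0 \<le> H2 J"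

definition aperiodic_instances :: "jrp set" where
  "aperiodic_instances = {J. nonneg_jrp J \<and> K0 J \<le> K1 J \<and> K0 J \<le> K2 J}"

definition periodic_instances :: "jrp set" where
  "periodic_instances = {J. nonneg_jrp J}"

definition aperiodic_cost :: "jrp \<Rightarrow> nat \<times> nat \<Rightarrow> rat" where
  "aperiodic_cost J = (\<lambda>(q1, q2).
     eoq_cost q1 (K1 J) (H1 J) + eoq_cost q2 (K2 J) (H2 J) - K0 J / of_nat (lcm q1 q2))"

definition periodic_cost :: "jrp \<Rightarrow> nat \<times> nat \<Rightarrow> rat" where
  "periodic_cost J = (\<lambda>(q1, q2).
     eoq_cost q1 (K1 J) (H1 J) + eoq_cost q2 (K2 J) (H2 J) + K0 J / of_nat (gcd q1 q2))"

text \<open>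
  A minimizer need not exist when a holding cost \<open>H1\<close> or \<open>H2\<close> vanishes; such instances have no
  solution.
\<close>

definition aperiodic_solution :: "jrp \<Rightarrow> nat \<times> nat \<Rightarrow> bool" where
  "aperiodic_solution J = is_arg_min (aperiodic_cost J) (\<lambda>(q1, q2). 0 < q1 \<and> 0 < q2)"

definition periodic_solution :: "jrp \<Rightarrow> nat \<times> nat \<Rightarrow> bool" where
  "periodic_solution J = is_arg_min (periodic_cost J) (\<lambda>(q1, q2). 0 < q1 \<and> 0 < q2)"

definition aperiodic_jrp_poly_time :: bool where
  "aperiodic_jrp_poly_time \<longleftrightarrow>
     poly_time_solvable encode_jrp encode_pair aperiodic_instances aperiodic_solution"

definition periodic_jrp_poly_time :: bool where
  "periodic_jrp_poly_time \<longleftrightarrow>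
     poly_time_solvable encode_jrp encode_pair periodic_instances periodic_solution"

section \<open>Integer factorization\<close>

text \<open>The output lists the prime factors with multiplicity, in any order.\<close>

definition factorization_poly_time :: bool where
  "factorization_poly_time \<longleftrightarrow>
     poly_time_solvable (\<lambda>M. [M]) (\<lambda>ps. ps) {M. 0 < M}
       (\<lambda>(M :: nat) ps. mset ps = prime_factorization M)"

end

theory Submission
  imports Defs
begin

text \<open>
  Holding cost \<open>16 m^2\<close> and setup cost \<open>16 m^4\<close> make the EOQ cost of the first item so steep
  around its minimum \<open>q1 = m\<close> that every optimal solution has \<open>q1 = m\<close>. What remains is an
  optimization over \<open>q2\<close> in which a large gcd with \<open>m\<close> is rewarded.

  In the periodic case take \<open>K0 = m\<close>, \<open>K2 = 0\<close>, \<open>H2 = 1\<close>: the remaining cost is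
  \<open>q2 + m / gcd m q2\<close>, so an optimal \<open>q2\<close> is a divisor \<open>d\<close> of \<open>m\<close> minimizing \<open>d + m / d\<close>, and the
  trivial divisors are the worst choice. In the aperiodic case take \<open>K0 = K2 = m^2\<close>, \<open>H2 = 4\<close>:
  for odd \<open>m\<close> the unique optimum is \<open>q2 = (m - g) / 2\<close> with \<open>g\<close> the largest proper divisor of \<open>m\<close>
  (for even \<open>m\<close> the divisor 2 is known anyway).

  Hence one oracle call finds a nontrivial divisor of a composite \<open>m\<close>; fewer than \<open>2 log M\<close> such
  calls factor \<open>M\<close>. Between two calls the stacks used by the oracle program are emptied, which is
  affordable because their contents are bounded by the time the program spent.
\<close>

section \<open>Running programs\<close>

primrec avars :: "aexp \<Rightarrow> nat set" where
  "avars (Const n) = {}"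
| "avars (Top x) = {x}"
| "avars (NonEmpty x) = {x}"
| "avars (Add a b) = avars a \<union> avars b"
| "avars (Sub a b) = avars a \<union> avars b"
| "avars (Mult a b) = avars a \<union> avars b"
| "avars (Div a b) = avars a \<union> avars b"

primrec cvars :: "com \<Rightarrow> nat set" where
  "cvars Skip = {}"
| "cvars (Push x a) = insert x (avars a)"
| "cvars (Pop x) = {x}"
| "cvars (Assign x a) = insert x (avars a)"
| "cvars (Seq c1 c2) = cvars c1 \<union> cvars c2"
| "cvars (If a c1 c2) = avars a \<union> cvars c1 \<union> cvars c2"
| "cvars (While a c) = avars a \<union> cvars c"

lemma finite_avars: "finite (avars a)"
  by (induction a) auto

lemma finite_cvars: "finite (cvars c)"
  by (induction c) (auto simp: finite_avars)

lemma aval_cong: "(\<And>x. x \<in> avars a \<Longrightarrow> s x = r x) \<Longrightarrow> aval a s = aval a r"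
  by (induction a) auto

lemma acost_cong: "(\<And>x. x \<in> avars a \<Longrightarrow> s x = r x) \<Longrightarrow> acost a s = acost a r"
  by (induction a) (auto cong: aval_cong)

text \<open>A run touches only the stacks in \<open>cvars c\<close>, so it can be replayed in any
  store that agrees on \<open>A\<close>. This lets an oracle program run beside the data of its
  caller. The superset \<open>A\<close> stays fixed in the passage to subprograms.\<close>

lemma exec_frame:
  assumes "exec c s t s'" "cvars c \<subseteq> A" "\<And>x. x \<in> A \<Longrightarrow> s x = r x"
  shows "exec c r t (override_on r s' A)"
  using assms
proof (induction arbitrary: r rule: exec.induct)
  case (Skip s)
  then have "override_on r s A = r" by (auto simp: override_on_def)
  then show ?case using exec.Skip by metis
next
  case (Push x a s)
  then have "aval a s = aval a r" "acost a s = acost a r"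
    by (auto intro!: aval_cong acost_cong)
  moreover have "override_on r (s(x := aval a s # s x)) A = r(x := aval a s # r x)"
    using Push by (auto simp: override_on_def)
  ultimately show ?case using exec.Push by metis
next
  case (Pop x s)
  then have "override_on r (s(x := tl (s x))) A = r(x := tl (r x))" "s x = r x"
    by (auto simp: override_on_def)
  then show ?case using exec.Pop by metis
next
  case (Assign x a s)
  then have "aval a s = aval a r" "acost a s = acost a r" "s x = r x"
    by (auto intro!: aval_cong acost_cong)
  moreover have "override_on r (s(x := aval a s # tl (s x))) A = r(x := aval a s # tl (r x))"
    using Assign by (auto simp: override_on_def)
  ultimately show ?case using exec.Assign by metis
next
  case (Seq c1 s1 t1 s2 c2 t2 s3)
  have 1: "exec c1 r t1 (override_on r s2 A)"
    using Seq.prems by (intro Seq.IH(1)) auto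
  have "exec c2 (override_on r s2 A) t2 (override_on (override_on r s2 A) s3 A)"
    using Seq.prems by (intro Seq.IH(2)) auto
  moreover have "override_on (override_on r s2 A) s3 A = override_on r s3 A"
    by (auto simp: override_on_def)
  ultimately show ?case using 1 by (auto intro: exec.Seq)
next
  case (IfTrue a s c1 t s' c2)
  have "aval a s = aval a r" "acost a s = acost a r"
    using IfTrue.prems by (auto intro!: aval_cong acost_cong)
  moreover have "exec c1 r t (override_on r s' A)"
    using IfTrue.prems by (intro IfTrue.IH) auto
  ultimately show ?case using IfTrue.hyps(1) exec.IfTrue by metis
next
  case (IfFalse a s c2 t s' c1)
  have "aval a s = aval a r" "acost a s = acost a r"
    using IfFalse.prems by (auto intro!: aval_cong acost_cong)
  moreover have "exec c2 r t (override_on r s' A)"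
    using IfFalse.prems by (intro IfFalse.IH) auto
  ultimately show ?case using IfFalse.hyps(1) exec.IfFalse by metis
next
  case (WhileFalse a s c)
  have "aval a s = aval a r" "acost a s = acost a r"
    using WhileFalse.prems by (auto intro!: aval_cong acost_cong)
  moreover have "override_on r s A = r"
    using WhileFalse by (auto simp: override_on_def)
  ultimately show ?case using WhileFalse.hyps(1) exec.WhileFalse by metis
next
  case (WhileTrue a s1 c t1 s2 t2 s3)
  have a: "aval a s1 = aval a r" "acost a s1 = acost a r"
    using WhileTrue.prems by (auto intro!: aval_cong acost_cong)
  have 1: "exec c r t1 (override_on r s2 A)"
    using WhileTrue.prems by (intro WhileTrue.IH(1)) auto
  have "exec (While a c) (override_on r s2 A) t2 (override_on (override_on r s2 A) s3 A)"
    using WhileTrue.prems by (intro WhileTrue.IH(2)) auto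
  moreover have "override_on (override_on r s2 A) s3 A = override_on r s3 A"
    by (auto simp: override_on_def)
  ultimately show ?case using 1 WhileTrue.hyps(1) a exec.WhileTrue by metis
qed

section \<open>Binary lengths and costs\<close>

lemma bits_pos: "1 \<le> bits n"
  by (simp add: bits_def)

lemma bits_mono: "m \<le> n \<Longrightarrow> bits m \<le> bits n"
  by (simp add: bits_def floorlog_mono)

lemma bits_le_iff: "bits n \<le> Suc k \<longleftrightarrow> n < 2 ^ k"
  by (simp add: bits_def floorlog_le_iff)

lemma less_two_power_bits: "n < 2 ^ (bits n - 1)"
  using bits_le_iff[of n "bits n - 1"] bits_pos[of n] by simp

lemma bits_add: "bits (m + n) \<le> bits m + bits n"
proof -
  \<comment> \<open>Successors turn the two strict bounds into factors, and the exponents of a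
    product add up.\<close>
  have "Suc (m + n) \<le> Suc m * Suc n" by simp
  also have "\<dots> \<le> 2 ^ (bits m - 1) * 2 ^ (bits n - 1)"
    by (intro mult_le_mono Suc_leI less_two_power_bits)
  finally have "bits (m + n) \<le> Suc (bits m - 1 + (bits n - 1))"
    by (simp only: bits_le_iff power_add Suc_le_eq)
  then show ?thesis using bits_pos[of m] by simp
qed

lemma bits_mult: "bits (m * n) \<le> bits m + bits n"
proof -
  have "m * n < 2 ^ (bits m - 1) * 2 ^ (bits n - 1)"
    using less_two_power_bits by (intro mult_strict_mono) auto
  then have "bits (m * n) \<le> Suc (bits m - 1 + (bits n - 1))"
    by (simp only: bits_le_iff power_add)
  then show ?thesis using bits_pos[of m] by simp
qed

text \<open>Each operation is charged for its operands, whose lengths bound that of the result. The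
  factor 2 is there for \<open>NonEmpty\<close>, which costs 1 although
  \<open>bits 1 = 2\<close>.\<close>

lemma bits_aval: "bits (aval a s) \<le> 2 * acost a s"
proof (induction a)
  case (NonEmpty x)
  have "bits 1 \<le> 2" using bits_le_iff[of 1 1] by simp
  then show ?case using bits_mono[of 0 1] by auto
next
  case (Add a b)
  then show ?case using bits_add[of "aval a s" "aval b s"] by simp
next
  case (Sub a b)
  then show ?case using bits_mono[of "aval a s - aval b s" "aval a s"] by simp
next
  case (Mult a b)
  then show ?case using bits_mult[of "aval a s" "aval b s"] by simp
next
  case (Div a b)
  then show ?case using bits_mono[of "aval a s div aval b s" "aval a s"] by simp
qed auto

text \<open>A fixed expression performs a fixed number of operations, each on numbers of length
  linear in \<open>B\<close>. The constant \<open>k\<close> is chosen before \<open>s\<close> and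
  \<open>B\<close>, so that it can serve as a coefficient of a time polynomial.\<close>

lemma acost_linear:
  "\<exists>k. \<forall>s B. 1 \<le> B \<longrightarrow> (\<forall>x\<in>avars a. bits (top_of (s x)) \<le> B) \<longrightarrow> acost a s \<le> k * B"
    (is "?linear a")
proof -
  have binary: "\<exists>k. \<forall>s B. 1 \<le> B \<longrightarrow> (\<forall>x\<in>avars a \<union> avars b. bits (top_of (s x)) \<le> B)
      \<longrightarrow> acost a s + acost b s + bits (aval a s) + bits (aval b s) \<le> k * B"
    if "?linear a" "?linear b" for a b
  proof -
    from that obtain k l where kl:
      "\<And>s B. 1 \<le> B \<Longrightarrow> \<forall>x\<in>avars a. bits (top_of (s x)) \<le> B \<Longrightarrow> acost a s \<le> k * B"
      "\<And>s B. 1 \<le> B \<Longrightarrow> \<forall>x\<in>avars b. bits (top_of (s x)) \<le> B \<Longrightarrow> acost b s \<le> l * B"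
      by metis
    \<comment> \<open>Each operand contributes its own cost and, by \<open>bits_aval\<close>, at
      most twice that cost for its length.\<close>
    have "acost a s + acost b s + bits (aval a s) + bits (aval b s) \<le> (3 * k + 3 * l) * B"
      if "1 \<le> B" "\<forall>x\<in>avars a \<union> avars b. bits (top_of (s x)) \<le> B" for s B
      using kl(1)[of B s] kl(2)[of B s] bits_aval[of a s] bits_aval[of b s] that
      by (simp add: algebra_simps)
    then show ?thesis by blast
  qed
  show ?thesis
  proof (induction a)
    case (Const n)
    show ?case by (intro exI[of _ "bits n"]) auto
  next
    case (Top x)
    show ?case by (intro exI[of _ 1]) simp
  next
    case (NonEmpty x)
    show ?case by (intro exI[of _ 1]) simp
  qed (simp_all only: acost.simps avars.simps binary)
qed

lemma bits_list_simps [simp]: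
  "bits_list [] = 0" "bits_list (x # xs) = bits x + bits_list xs"
  by (simp_all add: bits_list_def)

lemma bits_list_tl: "bits_list (tl xs) \<le> bits_list xs"
  by (cases xs) auto

text \<open>Every value put on a stack has been paid for, up to the factor 2 of
  \<open>bits_aval\<close>. This controls the size of an oracle answer and the time for clearing the
  stacks the oracle leaves behind.\<close>

lemma exec_stack_size: "exec c s t s' \<Longrightarrow> bits_list (s' x) \<le> bits_list (s x) + 2 * t"
proof (induction rule: exec.induct)
  case (Push y a s)
  then show ?case using bits_aval[of a s] by simp
next
  case (Pop y s)
  then show ?case using bits_list_tl[of "s y"] by simp
next
  case (Assign y a s)
  then show ?case using bits_aval[of a s] bits_list_tl[of "s y"] by simp
qed auto

lemma poly_nat_mono: "m \<le> n \<Longrightarrow> poly p m \<le> poly (p :: nat poly) n"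
  by (induction p) (auto intro!: add_mono mult_mono)

section \<open>Instances whose optima reveal a divisor\<close>

definition jrp_of_nats :: "nat \<Rightarrow> nat \<Rightarrow> nat \<Rightarrow> nat \<Rightarrow> nat \<Rightarrow> jrp" where
  "jrp_of_nats k0 k1 k2 h1 h2 =
     \<lparr>K0 = of_nat k0, K1 = of_nat k1, K2 = of_nat k2, H1 = of_nat h1, H2 = of_nat h2\<rparr>"

lemma encode_rat_of_nat: "encode_rat (of_nat n) = [n, 1]"
proof -
  have "quotient_of (of_nat n) = (int n, 1)"
    using quotient_of_int[of "int n"] by (simp add: Rat.of_int_def)
  then show ?thesis by (simp add: encode_rat_def)
qed

lemma encode_jrp_of_nats:
  "encode_jrp (jrp_of_nats k0 k1 k2 h1 h2) = [k0, 1, k1, 1, k2, 1, h1, 1, h2, 1]"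
  by (simp add: encode_jrp_def jrp_of_nats_def encode_rat_of_nat)

text \<open>The growth condition confines the pairs that cost no more than \<open>(1, 1)\<close> to
  a finite square, and a minimizer among them is global. Existence matters because a solver promises
  nothing on instances without a solution.\<close>

lemma exists_arg_min_pair:
  fixes f :: "nat \<times> nat \<Rightarrow> rat"
  assumes "\<And>a b. 0 < a \<Longrightarrow> 0 < b \<Longrightarrow> of_nat a + of_nat b \<le> f (a, b)"
  shows "\<exists>y. is_arg_min f (\<lambda>(a, b). 0 < a \<and> 0 < b) y"
proof -
  define c where "c = nat \<lceil>f (1, 1)\<rceil>"
  define S where "S = {(a, b). 0 < a \<and> 0 < b \<and> f (a, b) \<le> f (1, 1)}"
  have c: "f (1, 1) \<le> of_nat c"
    by (metis c_def of_nat_ceiling)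
  have "S \<subseteq> {..c} \<times> {..c}"
  proof
    fix p assume "p \<in> S"
    then obtain a b where p: "p = (a, b)" "0 < a" "0 < b" "f (a, b) \<le> f (1, 1)"
      by (auto simp: S_def)
    then have "(of_nat (a + b) :: rat) \<le> of_nat c"
      using assms[of a b] c by simp
    then have "a + b \<le> c" by (simp only: of_nat_le_iff)
    with p show "p \<in> {..c} \<times> {..c}" by simp
  qed
  then have "finite S" by (rule finite_subset) simp
  moreover have "S \<noteq> {}" by (auto simp: S_def intro!: exI[of _ 1])
  ultimately obtain y where y: "is_arg_min f (\<lambda>x. x \<in> S) y"
    using ex_is_arg_min_if_finite[of S f] by blast
  have "\<not> f z < f y" if "case z of (a, b) \<Rightarrow> 0 < a \<and> 0 < b" for z
  proof (cases "z \<in> S")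
    case False
    then have "f (1, 1) < f z" using that by (auto simp: S_def)
    moreover have "f y \<le> f (1, 1)" using y by (auto simp: is_arg_min_def S_def)
    ultimately show ?thesis by simp
  qed (use y in \<open>cases z; auto simp: is_arg_min_def\<close>)
  moreover have "case y of (a, b) \<Rightarrow> 0 < a \<and> 0 < b"
    using y by (auto simp: is_arg_min_def S_def)
  ultimately have "is_arg_min f (\<lambda>(a, b). 0 < a \<and> 0 < b) y"
    by (auto simp: is_arg_min_def)
  then show ?thesis ..
qed

lemma is_arg_min_pairD:
  fixes f :: "nat \<times> nat \<Rightarrow> rat"
  assumes "is_arg_min f (\<lambda>(a, b). 0 < a \<and> 0 < b) (q1, q2)"
  shows "0 < q1" "0 < q2" "\<And>a b. 0 < a \<Longrightarrow> 0 < b \<Longrightarrow> f (q1, q2) \<le> f (a, b)"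
proof -
  show "0 < q1" "0 < q2" using assms by (simp_all add: is_arg_min_def)
  fix a b :: nat assume "0 < a" "0 < b"
  moreover have "\<not> (case (a, b) of (a, b) \<Rightarrow> 0 < a \<and> 0 < b) \<or> \<not> f (a, b) < f (q1, q2)"
    using assms unfolding is_arg_min_def by blast
  ultimately show "f (q1, q2) \<le> f (a, b)" by auto
qed

section \<open>The EOQ cost of the first item around its minimum\<close>

lemma eoq_cost_at_optimum:
  assumes "0 < m"
  shows "eoq_cost m (of_nat (16 * m ^ 4)) (of_nat (16 * m ^ 2)) = 32 * of_nat m ^ 3"
  using assms by (simp add: eoq_cost_def field_simps eval_nat_numeral)

text \<open>The excess over \<open>32 m^3\<close> is \<open>16 m^2 (q - m)^2 / q\<close>, so the
  claim amounts to \<open>q \<le> 2 m (q - m)^2\<close>. The gap \<open>8 m\<close> exceeds what a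
  simple choice of \<open>q2\<close> costs at \<open>q1 = m\<close>: \<open>1 + m\<close> in the
  periodic and \<open>4 m\<close> in the aperiodic case.\<close>

lemma eoq_cost_off_optimum:
  assumes "0 < m" "0 < q" "q \<noteq> m"
  shows "32 * of_nat m ^ 3 + 8 * of_nat m
    \<le> eoq_cost q (of_nat (16 * m ^ 4)) (of_nat (16 * m ^ 2))"
proof -
  define k where "k = int q - int m"
  have "k \<noteq> 0" using assms by (simp add: k_def)
  then have "1 \<le> k\<^sup>2" "k \<le> k\<^sup>2"
    using power2_eq_square[of k] zero_less_power2[of k] self_le_power
    by (smt (verit) mult_le_cancel_right2 zero_le_power2)+
  \<comment> \<open>Here \<open>q = m + k\<close>, and both summands are at most
    \<open>m * k^2\<close> because \<open>k\<close> is a nonzero integer.\<close>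
  then have "int m * 1 + k * 1 \<le> int m * k\<^sup>2 + k\<^sup>2 * int m"
    using assms by (intro add_mono mult_mono) auto
  then have "int q \<le> 2 * int m * k\<^sup>2" by (simp add: k_def algebra_simps)
  then have "(of_int (int q) :: rat) \<le> of_int (2 * int m * k\<^sup>2)" by (simp only: of_int_le_iff)
  then have *: "(of_nat q :: rat) \<le> 2 * of_nat m * (of_nat q - of_nat m)\<^sup>2"
    by (simp add: k_def)
  define x y :: rat where xy: "x = of_nat q" "y = of_nat m"
  have pos: "0 < x" "0 < y" using assms by (auto simp: xy)
  have "x * (8 * y) \<le> (2 * y * (x - y)\<^sup>2) * (8 * y)"
    using * pos by (intro mult_right_mono) (auto simp: xy)
  then have "32 * y ^ 3 * x + 8 * y * x \<le> 16 * y ^ 4 + 16 * y\<^sup>2 * x * x"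
    by (simp add: algebra_simps eval_nat_numeral)
  then have "32 * y ^ 3 + 8 * y \<le> 16 * y ^ 4 / x + 16 * y\<^sup>2 * x"
    using pos by (simp add: field_simps)
  then show ?thesis by (simp add: eoq_cost_def xy)
qed

text \<open>A prime accepts every answer, so the solver is spared a primality test: for
  \<open>m \<ge> 2\<close>, an answer that fails trial division exposes \<open>m\<close> as
  prime.\<close>

definition divisor_search :: "nat \<Rightarrow> nat \<Rightarrow> bool" where
  "divisor_search m d \<longleftrightarrow> prime m \<or> d dvd m \<and> 1 < d \<and> d < m"

lemma nontrivial_divisorE:
  assumes "2 \<le> (m :: nat)" "\<not> prime m"
  obtains d e where "m = d * e" "1 < d" "1 < e"
proof -
  obtain d where d: "d dvd m" "d \<noteq> 1" "d \<noteq> m"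
    using assms by (auto simp: prime_nat_iff)
  then obtain e where "m = d * e" by auto
  with d assms that[of d e] show ?thesis
    by (cases "d = 0"; cases "e = 0"; cases "e = 1") auto
qed

definition periodic_instance :: "nat \<Rightarrow> jrp" where
  "periodic_instance m = jrp_of_nats m (16 * m ^ 4) 0 (16 * m ^ 2) 1"

definition aperiodic_instance :: "nat \<Rightarrow> jrp" where
  "aperiodic_instance m = jrp_of_nats (m ^ 2) (16 * m ^ 4) (m ^ 2) (16 * m ^ 2) 4"

lemma periodic_cost_instance:
  "periodic_cost (periodic_instance m) (q1, q2) =
     eoq_cost q1 (of_nat (16 * m ^ 4)) (of_nat (16 * m ^ 2)) + of_nat q2
     + of_nat m / of_nat (gcd q1 q2)"
  by (simp add: periodic_cost_def periodic_instance_def jrp_of_nats_def eoq_cost_def)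

lemma aperiodic_cost_instance:
  "aperiodic_cost (aperiodic_instance m) (q1, q2) =
     eoq_cost q1 (of_nat (16 * m ^ 4)) (of_nat (16 * m ^ 2))
     + (of_nat m ^ 2 / of_nat q2 - of_nat m ^ 2 / of_nat (lcm q1 q2)) + 4 * of_nat q2"
  by (simp add: aperiodic_cost_def aperiodic_instance_def jrp_of_nats_def eoq_cost_def)

lemma lcm_saving_nonneg:
  assumes "0 < q1" "0 < q2"
  shows "0 \<le> (of_nat m :: rat) ^ 2 / of_nat q2 - of_nat m ^ 2 / of_nat (lcm q1 q2)"
proof -
  have "q2 \<le> lcm q1 q2" using assms by (simp add: dvd_imp_le lcm_pos_nat)
  then have "(of_nat q2 :: rat) \<le> of_nat (lcm q1 q2)" by (simp only: of_nat_le_iff)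
  then show ?thesis using assms by (simp add: divide_left_mono)
qed

text \<open>The holding rate is at least 1, which gives the growth demanded by
  \<open>exists_arg_min_pair\<close>.\<close>

lemma eoq_cost_instance_ge:
  assumes "0 < m"
  shows "of_nat q \<le> eoq_cost q (of_nat (16 * m ^ 4)) (of_nat (16 * m ^ 2))"
proof -
  have "1 \<le> 16 * m ^ 2" using assms by (simp add: Suc_leI)
  then have "(of_nat 1 :: rat) \<le> of_nat (16 * m ^ 2)" by (simp only: of_nat_le_iff)
  then have "(1::rat) * of_nat q \<le> of_nat (16 * m ^ 2) * of_nat q"
    by (intro mult_right_mono) simp_all
  moreover have "0 \<le> of_nat (16 * m ^ 4) / (of_nat q :: rat)" by simp
  ultimately show ?thesis unfolding eoq_cost_def by linarith
qed

lemma periodic_instance_solvable: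
  assumes "0 < m"
  shows "\<exists>y. periodic_solution (periodic_instance m) y"
  unfolding periodic_solution_def
proof (rule exists_arg_min_pair)
  fix a b :: nat
  have "0 \<le> (of_nat m / of_nat (gcd a b) :: rat)" by simp
  then show "of_nat a + of_nat b \<le> periodic_cost (periodic_instance m) (a, b)"
    using eoq_cost_instance_ge[OF assms, of a] unfolding periodic_cost_instance by linarith
qed

lemma aperiodic_instance_solvable:
  assumes "0 < m"
  shows "\<exists>y. aperiodic_solution (aperiodic_instance m) y"
  unfolding aperiodic_solution_def
proof (rule exists_arg_min_pair)
  fix a b :: nat assume "0 < a" "0 < b"
  from lcm_saving_nonneg[OF this, of m]
  show "of_nat a + of_nat b \<le> aperiodic_cost (aperiodic_instance m) (a, b)"
    using eoq_cost_instance_ge[OF assms, of a] of_nat_0_le_iff[of b, where ?'a = rat]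
    unfolding aperiodic_cost_instance by linarith
qed

section \<open>Optima of the periodic instances\<close>

lemma periodic_instance_divisor:
  assumes m: "2 \<le> m" and sol: "periodic_solution (periodic_instance m) (q1, q2)"
  shows "divisor_search m q2"
proof (cases "prime m")
  case False
  let ?f = "periodic_cost (periodic_instance m)"
  have q: "0 < q1" "0 < q2" and opt: "\<And>a b. 0 < a \<Longrightarrow> 0 < b \<Longrightarrow> ?f (q1, q2) \<le> ?f (a, b)"
    using is_arg_min_pairD[OF sol[unfolded periodic_solution_def]] by blast+
  have f_m: "?f (m, b) = 32 * of_nat m ^ 3 + of_nat b + of_nat m / of_nat (gcd m b)" for b
    unfolding periodic_cost_instance using m by (simp only: eoq_cost_at_optimum)
  have q1: "q1 = m"
  proof (rule ccontr)
    \<comment> \<open>The competitor \<open>(m, 1)\<close> costs only \<open>1 + m\<close> beyond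
      \<open>32 m^3\<close>, which is below the penalty \<open>8 m\<close>.\<close>
    assume "q1 \<noteq> m"
    then have "32 * of_nat m ^ 3 + 8 * of_nat m
        \<le> eoq_cost q1 (of_nat (16 * m ^ 4)) (of_nat (16 * m ^ 2))"
      using m q by (intro eoq_cost_off_optimum) auto
    moreover have "(0 :: rat) \<le> of_nat m / of_nat (gcd q1 q2)" by simp
    ultimately have "32 * of_nat m ^ 3 + 8 * of_nat m \<le> ?f (q1, q2)"
      unfolding periodic_cost_instance using of_nat_0_le_iff[of q2, where ?'a = rat]
      by linarith
    moreover have "?f (q1, q2) \<le> ?f (m, 1)" using m by (intro opt) auto
    moreover have "(2 :: rat) \<le> of_nat m" using m by simp
    ultimately show False by (simp add: f_m)
  qed
  obtain d e where de: "m = d * e" "1 < d" "1 < e"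
    using nontrivial_divisorE[OF m False] .
  have "gcd m d = d" "(of_nat m / of_nat d :: rat) = of_nat e"
    using de by (simp_all add: gcd_proj2_if_dvd)
  then have "?f (m, d) = 32 * of_nat m ^ 3 + (of_nat d + of_nat e)"
    by (simp only: f_m add.assoc)
  moreover have "(of_nat d + of_nat e :: rat) < 1 + of_nat m"
  proof -
    \<comment> \<open>The product is \<open>m - d - e + 1\<close>, so \<open>d + e\<close> beats the
      value \<open>1 + m\<close> of the trivial divisors.\<close>
    have "0 < (int d - 1) * (int e - 1)" using de by simp
    then have "int d + int e < 1 + int m" using de by (simp add: algebra_simps)
    then have "d + e < 1 + m" by linarith
    then show ?thesis by (simp flip: of_nat_add of_nat_Suc)
  qed
  moreover have "?f (q1, q2) \<le> ?f (m, d)" using de by (intro opt) auto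
  ultimately have less: "?f (m, q2) < 32 * of_nat m ^ 3 + 1 + of_nat m"
    by (simp add: q1)
  \<comment> \<open>Replacing \<open>q2\<close> by \<open>gcd m q2\<close> preserves the gcd term
    and cannot raise the holding cost, so an optimal \<open>q2\<close> already divides
    \<open>m\<close>.\<close>
  have "?f (m, q2) \<le> ?f (m, gcd m q2)"
    using opt[of m "gcd m q2"] m by (simp add: q1)
  then have "q2 \<le> gcd m q2" by (simp add: f_m)
  then have "gcd m q2 = q2" using q by (simp add: dvd_imp_le le_antisym gcd_le2_nat)
  then have "q2 dvd m" by (metis gcd_dvd1)
  moreover have "q2 \<noteq> 1" "q2 \<noteq> m" using less m by (auto simp: f_m)
  ultimately show ?thesis using q m by (auto simp: divisor_search_def dest: dvd_imp_le)
qed (simp add: divisor_search_def)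

section \<open>Optima of the aperiodic instances\<close>

text \<open>
  At \<open>q1 = m\<close> the cost is \<open>32 m^3 + 4 m + ((m - 2 q2)^2 - m g) / q2\<close> with \<open>g = gcd m q2\<close>.
  For odd \<open>m\<close> and a proper divisor \<open>d\<close> of \<open>m\<close>, the choice \<open>q2 = (m - d) / 2\<close> saves \<open>2 d\<close>,
  and nothing else with the same gcd saves as much.
\<close>

lemma aperiodic_instance_divisor:
  assumes m: "2 \<le> m" and odd: "odd m"
    and sol: "aperiodic_solution (aperiodic_instance m) (q1, q2)"
  shows "divisor_search m (m - 2 * q2)"
proof (cases "prime m")
  case False
  let ?f = "aperiodic_cost (aperiodic_instance m)"
  have q: "0 < q1" "0 < q2" and opt: "\<And>a b. 0 < a \<Longrightarrow> 0 < b \<Longrightarrow> ?f (q1, q2) \<le> ?f (a, b)"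
    using is_arg_min_pairD[OF sol[unfolded aperiodic_solution_def]] by blast+
  define v :: "nat \<Rightarrow> rat" where
    "v b = of_nat m ^ 2 / of_nat b - of_nat m ^ 2 / of_nat (lcm m b) + 4 * of_nat b" for b
  have f_m: "?f (m, b) = 32 * of_nat m ^ 3 + v b" for b
    unfolding aperiodic_cost_instance v_def using m by (simp only: eoq_cost_at_optimum)
  have q1: "q1 = m"
  proof (rule ccontr)
    \<comment> \<open>The competitor \<open>(m, m)\<close> has \<open>v m = 4 m\<close>, again less
      than the penalty \<open>8 m\<close>.\<close>
    assume "q1 \<noteq> m"
    then have "32 * of_nat m ^ 3 + 8 * of_nat m
        \<le> eoq_cost q1 (of_nat (16 * m ^ 4)) (of_nat (16 * m ^ 2))"
      using m q by (intro eoq_cost_off_optimum) auto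
    moreover note lcm_saving_nonneg[OF q, of m]
    ultimately have "32 * of_nat m ^ 3 + 8 * of_nat m \<le> ?f (q1, q2)"
      unfolding aperiodic_cost_instance using of_nat_0_le_iff[of q2, where ?'a = rat]
      by linarith
    moreover have "?f (q1, q2) \<le> ?f (m, m)" using m by (intro opt) auto
    moreover have "(2 :: rat) \<le> of_nat m" using m by simp
    ultimately show False by (simp add: f_m v_def)
  qed
  have v_opt: "v q2 \<le> 4 * of_nat m - 2 * of_nat d" if "d dvd m" "d < m" for d
  proof -
    obtain e where e: "m = d * e" using \<open>d dvd m\<close> by auto
    with odd have "Parity.odd d" "Parity.odd e" by auto
    \<comment> \<open>The cofactor \<open>e\<close> is odd, so \<open>j = (e - 1) / 2\<close> is an
      integer and \<open>d * j\<close> equals \<open>(m - d) / 2\<close>.\<close>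
    then obtain j where j: "e = 2 * j + 1" by (auto elim: oddE)
    define b where "b = d * j"
    have d: "0 < d" "0 < j" using e j that by (auto intro: Nat.gr0I)
    have b: "0 < b" "m = 2 * b + d" using d by (auto simp: b_def e j algebra_simps)
    \<comment> \<open>The common multiple \<open>m * j\<close> bounds the lcm from above, hence the
      saving from below.\<close>
    have "lcm m b dvd m * j" by (intro lcm_least) (auto simp: b_def e)
    then have "lcm m b \<le> m * j" using d m by (intro dvd_imp_le) auto
    then have "(of_nat (lcm m b) :: rat) \<le> of_nat (m * j)" by (simp only: of_nat_le_iff)
    moreover have "(0 :: rat) < of_nat (m * j)" "(0 :: rat) < of_nat (lcm m b)"
      using b(1) d m unfolding of_nat_0_less_iff by (auto simp: lcm_pos_nat)
    ultimately have "of_nat m ^ 2 / of_nat (m * j) \<le> (of_nat m ^ 2 / of_nat (lcm m b) :: rat)"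
      by (intro divide_left_mono mult_pos_pos) auto
    then have "v b \<le> of_nat m ^ 2 / of_nat b - of_nat m ^ 2 / of_nat (m * j) + 4 * of_nat b"
      by (simp add: v_def)
    also have "of_nat m ^ 2 / of_nat (m * j) = (of_nat m * of_nat d / of_nat b :: rat)"
      using d m by (simp add: b_def power2_eq_square)
    also have "(of_nat m ^ 2 / of_nat b - of_nat m * of_nat d / of_nat b + 4 * of_nat b :: rat)
        = 4 * of_nat m - 2 * of_nat d"
      using b(1) unfolding b(2) by (simp add: field_simps power2_eq_square)
    finally have "v b \<le> 4 * of_nat m - 2 * of_nat d" .
    moreover have "v q2 \<le> v b" using opt[of m b] b(1) m by (simp add: f_m q1)
    ultimately show ?thesis by (rule order.trans[rotated])
  qed
  obtain d e where de: "m = d * e" "1 < d" "1 < e"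
    using nontrivial_divisorE[OF m False] .
  define g where "g = gcd m q2"
  define k where "k = int m - 2 * int q2"
  have g: "g dvd m" "g dvd q2" "0 < g" using m by (auto simp: g_def)
  \<comment> \<open>The identity \<open>g * lcm m q2 = m * q2\<close> trades the lcm for the gcd;
    multiplying by \<open>q2\<close> clears the fractions.\<close>
  have v_q2: "v q2 * of_nat q2 = of_nat m ^ 2 - of_nat m * of_nat g + 4 * of_nat q2 ^ 2"
  proof -
    have "(of_nat g * of_nat (lcm m q2) :: rat) = of_nat m * of_nat q2"
      unfolding g_def of_nat_mult[symmetric] by (simp only: prod_gcd_lcm_nat[symmetric])
    then have "of_nat m ^ 2 * of_nat q2 = of_nat m * of_nat g * (of_nat (lcm m q2) :: rat)"
      by (simp only: power2_eq_square mult.assoc)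
    moreover have "(of_nat (lcm m q2) :: rat) \<noteq> 0" "(of_nat q2 :: rat) \<noteq> 0" using m q by auto
    ultimately have "of_nat m ^ 2 / (of_nat (lcm m q2) :: rat) = of_nat m * of_nat g / of_nat q2"
      by (metis frac_eq_eq)
    then show ?thesis using q by (simp add: v_def field_simps power2_eq_square)
  qed
  \<comment> \<open>The comparison with the competitor built from \<open>c\<close>, completed to the
    square of \<open>k = m - 2 q2\<close>. It is applied with \<open>c = g\<close> and with
    \<open>c = d\<close>.\<close>
  have bound: "k\<^sup>2 - int m * int g \<le> - 2 * int c * int q2" if "c dvd m" "c < m" for c
  proof -
    have "v q2 * of_nat q2 \<le> (4 * of_nat m - 2 * of_nat c) * of_nat q2"
      using v_opt[OF that] by (intro mult_right_mono) auto
    then have "(of_int (int m ^ 2 - int m * int g + 4 * int q2 ^ 2) :: rat)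
        \<le> of_int ((4 * int m - 2 * int c) * int q2)"
      unfolding v_q2 by simp
    then have "int m ^ 2 - int m * int g + 4 * int q2 ^ 2 \<le> (4 * int m - 2 * int c) * int q2"
      by (simp only: of_int_le_iff)
    then show ?thesis by (simp add: k_def power2_eq_square algebra_simps)
  qed
  have d: "d dvd m" "d < m" using de by auto
  have "g \<noteq> m"
  proof
    \<comment> \<open>Then \<open>q2 \<ge> m\<close>, hence \<open>k \<le> - m\<close> and
      \<open>k^2 \<ge> m * g\<close>, against the negative bound for \<open>c = d\<close>.\<close>
    assume "g = m"
    then have "m \<le> q2" using g q by (auto intro: dvd_imp_le)
    then have "m * 1 \<le> q2 * 1" "int m \<le> - k" by (simp_all add: k_def)
    then have "int m * int m \<le> (- k) * (- k)" by (intro mult_mono) auto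
    then have "0 \<le> k\<^sup>2 - int m * int g" by (simp add: \<open>g = m\<close> power2_eq_square)
    moreover have "0 < int d * int q2" using de q by simp
    ultimately show False using bound[OF d] by simp
  qed
  then have "g < m" using dvd_imp_le[OF g(1)] m \<open>g \<noteq> m\<close> by linarith
  \<comment> \<open>For \<open>c = g\<close> the bound collapses to \<open>k^2 \<le> g * k\<close>.
    Since \<open>m\<close> is odd, \<open>k\<close> is nonzero, so it lies between 1 and
    \<open>g\<close>; as \<open>g\<close> divides it, only \<open>k = g\<close> remains.\<close>
  have k_le: "k\<^sup>2 \<le> int g * k"
    using bound[OF g(1) \<open>g < m\<close>] by (simp add: k_def algebra_simps power2_eq_square)
  have "k \<noteq> 0" using odd unfolding k_def by presburger
  then have "0 < int g * k" using k_le by (intro less_le_trans[OF _ k_le]) simp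
  then have k: "0 < k" using g by (simp add: zero_less_mult_iff)
  then have "k \<le> int g" using k_le by (simp add: power2_eq_square)
  moreover have "int g dvd k" using g by (auto simp: k_def)
  ultimately have k_g: "k = int g" using k by (simp add: zdvd_imp_le order_antisym)
  then have "m - 2 * q2 = g" by (simp add: k_def)
  moreover have "1 < g"
  proof -
    \<comment> \<open>With \<open>m - g = 2 q2\<close> the left side of the bound for
      \<open>c = d\<close> becomes \<open>- 2 g q2\<close>, so \<open>g\<close> is at least the
      nontrivial divisor \<open>d\<close>.\<close>
    have "int d * int q2 \<le> int g * int q2"
      using bound[OF d] k_g by (simp add: k_def algebra_simps power2_eq_square)
    then have "d \<le> g" using q by simp
    then show ?thesis using de by simp
  qed
  ultimately show ?thesis using g \<open>g < m\<close> by (simp add: divisor_search_def)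
qed (simp add: divisor_search_def)

section \<open>From joint replenishment to divisor search\<close>

text \<open>Upper bounds in place of exact costs can be rounded to polynomials and can cover
  branches of different cost.\<close>

definition exec_within :: "com \<Rightarrow> store \<Rightarrow> nat \<Rightarrow> store \<Rightarrow> bool" where
  "exec_within c s T s' \<longleftrightarrow> (\<exists>t\<le>T. exec c s t s')"

lemma exec_within_mono: "exec_within c s T s' \<Longrightarrow> T \<le> T' \<Longrightarrow> exec_within c s T' s'"
  unfolding exec_within_def by (meson order.trans)

lemma exec_within_Seq:
  "exec_within c1 s T1 s' \<Longrightarrow> exec_within c2 s' T2 s'' \<Longrightarrow> exec_within (Seq c1 c2) s (T1 + T2) s''"
  unfolding exec_within_def by (meson add_le_mono exec.Seq)

lemma exec_within_Skip: "exec_within Skip s 1 s"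
  unfolding exec_within_def using exec.Skip by blast

lemma exec_within_Push:
  "s' = s(x := aval a s # s x) \<Longrightarrow> exec_within (Push x a) s (1 + acost a s) s'"
  unfolding exec_within_def using exec.Push by blast

lemma exec_within_Pop:
  "s' = s(x := tl (s x)) \<Longrightarrow> exec_within (Pop x) s (1 + bits (top_of (s x))) s'"
  unfolding exec_within_def using exec.Pop by blast

lemma exec_within_Assign:
  "s' = s(x := aval a s # tl (s x))
    \<Longrightarrow> exec_within (Assign x a) s (1 + acost a s + bits (top_of (s x))) s'"
  unfolding exec_within_def using exec.Assign by blast

lemma exec_within_IfTrue:
  "aval a s \<noteq> 0 \<Longrightarrow> exec_within c1 s T s' \<Longrightarrow> exec_within (If a c1 c2) s (1 + acost a s + T) s'"
  unfolding exec_within_def by (meson add_le_cancel_left exec.IfTrue)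

lemma exec_within_IfFalse:
  "aval a s = 0 \<Longrightarrow> exec_within c2 s T s' \<Longrightarrow> exec_within (If a c1 c2) s (1 + acost a s + T) s'"
  unfolding exec_within_def by (meson add_le_cancel_left exec.IfFalse)

lemma exec_within_WhileFalse:
  "aval a s = 0 \<Longrightarrow> exec_within (While a c) s (1 + acost a s) s"
  unfolding exec_within_def using exec.WhileFalse by blast

lemma exec_within_WhileTrue:
  "aval a s \<noteq> 0 \<Longrightarrow> exec_within c s T s' \<Longrightarrow> exec_within (While a c) s' T' s''
    \<Longrightarrow> exec_within (While a c) s (1 + acost a s + T + T') s''"
  unfolding exec_within_def by (meson add_le_mono exec.WhileTrue order_refl)

lemma top_of_simps [simp]: "top_of [] = 0" "top_of (x # xs) = x"
  by (simp_all add: top_of_def)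

text \<open>The tail is pushed first, so that the first value ends on top, as the input convention
  demands.\<close>

primrec push_all :: "nat \<Rightarrow> aexp list \<Rightarrow> com" where
  "push_all x [] = Skip"
| "push_all x (a # as) = Seq (push_all x as) (Push x a)"

text \<open>No expression reads the stack that is growing, so all of them keep the values they have
  in the initial store.\<close>

lemma exec_push_all:
  assumes "\<And>a. a \<in> set as \<Longrightarrow> x \<notin> avars a"
  shows "exec_within (push_all x as) s (1 + (\<Sum>a\<leftarrow>as. 1 + acost a s))
    (s(x := map (\<lambda>a. aval a s) as @ s x))"
  using assms
proof (induction as)
  case Nil
  show ?case using exec_within_Skip by simp
next
  case (Cons a as)
  let ?s = "s(x := map (\<lambda>a. aval a s) as @ s x)"
  have a: "aval a ?s = aval a s" "acost a ?s = acost a s"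
    using Cons.prems[of a] by (auto intro!: aval_cong acost_cong)
  have "exec_within (push_all x as) s (1 + (\<Sum>a\<leftarrow>as. 1 + acost a s)) ?s"
    by (rule Cons.IH) (use Cons.prems in auto)
  moreover have "exec_within (Push x a) ?s (1 + acost a ?s)
      (s(x := map (\<lambda>a. aval a s) (a # as) @ s x))"
    by (rule exec_within_Push) (simp add: a(1))
  ultimately have "exec_within (push_all x (a # as)) s
      (1 + (\<Sum>a\<leftarrow>as. 1 + acost a s) + (1 + acost a ?s))
      (s(x := map (\<lambda>a. aval a s) (a # as) @ s x))"
    unfolding push_all.simps by (rule exec_within_Seq)
  then show ?case by (rule exec_within_mono) (simp add: a(2))
qed

lemma sum_list_acost_linear:
  "\<exists>k. \<forall>s B. 1 \<le> B \<longrightarrow> (\<forall>a\<in>set as. \<forall>x\<in>avars a. bits (top_of (s x)) \<le> B)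
     \<longrightarrow> (\<Sum>a\<leftarrow>as. 1 + acost a s) \<le> k * B"
proof (induction as)
  case (Cons a as)
  obtain k where k: "\<And>s B. 1 \<le> B \<Longrightarrow> \<forall>x\<in>avars a. bits (top_of (s x)) \<le> B \<Longrightarrow> acost a s \<le> k * B"
    using acost_linear by metis
  from Cons obtain l where l: "\<And>s B. 1 \<le> B \<Longrightarrow> \<forall>a\<in>set as. \<forall>x\<in>avars a. bits (top_of (s x)) \<le> B
      \<Longrightarrow> (\<Sum>a\<leftarrow>as. 1 + acost a s) \<le> l * B"
    by metis
  have "(\<Sum>a\<leftarrow>a # as. 1 + acost a s) \<le> (1 + k + l) * B"
    if "1 \<le> B" "\<forall>a\<in>set (a # as). \<forall>x\<in>avars a. bits (top_of (s x)) \<le> B" for s B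
    using k[of B s] l[of B s] that by (simp add: algebra_simps)
  then show ?case by blast
qed auto

lemma bits_list_aval: "bits_list (map (\<lambda>a. aval a s) as) \<le> 2 * (\<Sum>a\<leftarrow>as. 1 + acost a s)"
proof (induction as)
  case (Cons a as)
  then show ?case using bits_aval[of a s] by simp
qed simp

text \<open>The stacks from \<open>n\<close> on are free for a caller of \<open>c\<close>;
  \<open>0 < n\<close> puts the input and output stack 0 into the block owned by
  \<open>c\<close>.\<close>

lemma obtain_fresh:
  obtains n where "cvars c \<subseteq> {..<n}" "0 < n"
proof -
  obtain n where "\<forall>x\<in>cvars c. x < n"
    using finite_cvars finite_nat_set_iff_bounded by blast
  then have "cvars c \<subseteq> {..<Suc n}" by auto
  then show ?thesis using that by blast
qed

lemma exec_within_frame: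
  assumes "exec c (init_store xs) t s'" "t \<le> T" "cvars c \<subseteq> {..<n}" "0 < n"
    and "r 0 = xs" "\<And>x. 0 < x \<Longrightarrow> x < n \<Longrightarrow> r x = []"
  shows "exec_within c r T (override_on r s' {..<n})"
proof -
  have "exec c r t (override_on r s' {..<n})"
    by (rule exec_frame[OF assms(1,3)]) (use assms in \<open>auto simp: init_store_def\<close>)
  with \<open>t \<le> T\<close> show ?thesis by (auto simp: exec_within_def)
qed

text \<open>Both problems share this reduction: \<open>es n\<close> computes the encoded instance
  from \<open>m\<close>, saved on stack \<open>n\<close>, and \<open>out n\<close> turns
  \<open>q2\<close> and \<open>m\<close> into a divisor. Both depend on \<open>n\<close> because a
  free stack is known only once the solver program is given.\<close>

lemma divisor_search_by_one_query:
  fixes es :: "nat \<Rightarrow> aexp list" and out :: "nat \<Rightarrow> aexp"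
  assumes solver: "poly_time_solvable enc encode_pair I R"
    and es_vars: "\<And>n a. a \<in> set (es n) \<Longrightarrow> avars a \<subseteq> {n}"
    and es_val: "\<And>n s. map (\<lambda>a. aval a s) (es n) = enc (f (top_of (s n)))"
    and inst: "\<And>m. 2 \<le> m \<Longrightarrow> f m \<in> I \<and> (\<exists>y. R (f m) y)"
    and out_vars: "\<And>n. avars (out n) \<subseteq> {0, n}"
    and out_val: "\<And>n m q1 q2 s. 2 \<le> m \<Longrightarrow> R (f m) (q1, q2) \<Longrightarrow> top_of (s 0) = q2
      \<Longrightarrow> top_of (s n) = m \<Longrightarrow> divisor_search m (aval (out n) s)"
  shows "poly_time_solvable (\<lambda>m. [m]) (\<lambda>d. [d]) {m. 2 \<le> m} divisor_search"
proof -
  from solver obtain c p where c: "\<And>x. x \<in> I \<Longrightarrow> \<exists>y. R x y \<Longrightarrow>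
      \<exists>t s y. exec c (init_store (enc x)) t s \<and> t \<le> poly p (bits_list (enc x))
        \<and> s 0 = encode_pair y \<and> R x y"
    unfolding poly_time_solvable_def by metis
  obtain n where n: "cvars c \<subseteq> {..<n}" "0 < n" by (rule obtain_fresh)
  obtain k where k: "\<And>s B. 1 \<le> B \<Longrightarrow> \<forall>a\<in>set (es n). \<forall>x\<in>avars a. bits (top_of (s x)) \<le> B
      \<Longrightarrow> (\<Sum>a\<leftarrow>es n. 1 + acost a s) \<le> k * B"
    using sum_list_acost_linear[of "es n"] by metis
  obtain l where l: "\<And>s B. 1 \<le> B \<Longrightarrow> \<forall>x\<in>avars (out n). bits (top_of (s x)) \<le> B
      \<Longrightarrow> acost (out n) s \<le> l * B"
    using acost_linear[of "out n"] by metis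
  \<comment> \<open>Save \<open>m\<close>, empty stack 0, write the instance, run the solver, drop
    \<open>q1\<close>, and overwrite \<open>q2\<close> by the answer.\<close>
  define d where "d = Seq (Push n (Top 0)) (Seq (Pop 0) (Seq (push_all 0 (es n))
    (Seq c (Seq (Pop 0) (Assign 0 (out n))))))"
  \<comment> \<open>The encoded instance has length at most \<open>2 * k * bits m\<close>, so
    \<open>q\<close> bounds the solver time in terms of \<open>bits m\<close>. By
    \<open>exec_stack_size\<close>, \<open>w\<close> bounds the solver's output; its extra linear
    term makes it dominate \<open>bits m\<close> too.\<close>
  define q where "q = pcompose p [:0, 2 * k:]"
  define w where "w = [:0, 1 + 2 * k:] + smult 2 q"
  have bound: "\<exists>t s y. exec d (init_store [m]) t s
        \<and> t \<le> poly ([:5, 2 + k:] + q + smult (2 + l) w) (bits_list [m])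
        \<and> s 0 = [y] \<and> divisor_search m y" if m: "2 \<le> m" for m
  proof -
    let ?B = "bits m"
    obtain t s q1 q2 where run: "exec c (init_store (enc (f m))) t s"
      and t: "t \<le> poly p (bits_list (enc (f m)))"
      and s: "s 0 = [q1, q2]" and R: "R (f m) (q1, q2)"
      using c[of "f m"] inst[OF m] by (auto simp: encode_pair_def)
    define s1 where "s1 = (init_store [])(n := [m])"
    define s2 where "s2 = s1(0 := enc (f m))"
    define s3 where "s3 = override_on s2 s {..<n}"
    define s4 where "s4 = s3(0 := [q2])"
    have vals: "map (\<lambda>a. aval a s1) (es n) = enc (f m)"
      using es_val[of s1 n] by (simp add: s1_def)
    have cost: "(\<Sum>a\<leftarrow>es n. 1 + acost a s1) \<le> k * ?B"
      using es_vars[of _ n] by (intro k bits_pos) (auto simp: s1_def)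
    have size: "bits_list (enc (f m)) \<le> 2 * k * ?B"
      using bits_list_aval[of s1 "es n"] cost unfolding vals by simp
    have t': "t \<le> poly q ?B"
      using t poly_nat_mono[OF size, of p] by (simp add: q_def poly_pcompose algebra_simps)
    have "bits_list (s 0) \<le> bits_list (enc (f m)) + 2 * t"
      using exec_stack_size[OF run, of 0] by (simp add: init_store_def)
    then have q2: "bits q1 \<le> poly w ?B" "bits q2 \<le> poly w ?B"
      using size t' by (simp_all add: s w_def algebra_simps)
    have B: "?B \<le> poly w ?B" by (simp add: w_def)
    have e1: "exec_within (Push n (Top 0)) (init_store [m]) (1 + ?B) ((init_store [m])(n := [m]))"
      by (rule exec_within_mono[OF exec_within_Push]) (use n in \<open>auto simp: init_store_def\<close>)
    have e2: "exec_within (Pop 0) ((init_store [m])(n := [m])) (1 + ?B) s1"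
      by (rule exec_within_mono[OF exec_within_Pop]) (use n in \<open>auto simp: init_store_def s1_def\<close>)
    have "s2 = s1(0 := map (\<lambda>a. aval a s1) (es n) @ s1 0)"
      using n unfolding vals s2_def by (simp add: s1_def init_store_def)
    then have e3: "exec_within (push_all 0 (es n)) s1 (1 + k * ?B) s2"
      using es_vars[of _ n] n cost
      by (auto intro!: exec_within_mono[OF exec_push_all])
    have e4: "exec_within c s2 (poly q ?B) s3"
      unfolding s3_def using n
      by (intro exec_within_frame[OF run t']) (auto simp: s2_def s1_def init_store_def)
    have e5: "exec_within (Pop 0) s3 (1 + poly w ?B) s4"
      using q2 n by (intro exec_within_mono[OF exec_within_Pop]) (auto simp: s4_def s3_def s)
    have s4: "s4 0 = [q2]" "s4 n = [m]"
      using n by (auto simp: s4_def s3_def s2_def s1_def)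
    have out_cost: "acost (out n) s4 \<le> l * poly w ?B"
      using out_vars[of n] s4 q2 B bits_pos[of m] by (intro l) auto
    have e6: "exec_within (Assign 0 (out n)) s4 (1 + l * poly w ?B + poly w ?B)
        (s4(0 := [aval (out n) s4]))"
      using out_cost q2 by (intro exec_within_mono[OF exec_within_Assign]) (auto simp: s4)
    have "exec_within d (init_store [m])
        (1 + ?B + (1 + ?B + (1 + k * ?B + (poly q ?B + (1 + poly w ?B + (1 + l * poly w ?B + poly w ?B))))))
        (s4(0 := [aval (out n) s4]))"
      unfolding d_def by (intro exec_within_Seq[OF e1] exec_within_Seq[OF e2]
          exec_within_Seq[OF e3] exec_within_Seq[OF e4] exec_within_Seq[OF e5] e6)
    moreover have out: "divisor_search m (aval (out n) s4)"
      using out_val[OF m R, of s4 n] s4 by simp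
    moreover have "1 + ?B + (1 + ?B + (1 + k * ?B + (poly q ?B + (1 + poly w ?B + (1 + l * poly w ?B + poly w ?B)))))
        \<le> poly ([:5, 2 + k:] + q + smult (2 + l) w) (bits_list [m])"
      by (simp add: algebra_simps)
    ultimately have "exec_within d (init_store [m])
        (poly ([:5, 2 + k:] + q + smult (2 + l) w) (bits_list [m])) (s4(0 := [aval (out n) s4]))"
      using exec_within_mono by blast
    then obtain t where "t \<le> poly ([:5, 2 + k:] + q + smult (2 + l) w) (bits_list [m])"
      "exec d (init_store [m]) t (s4(0 := [aval (out n) s4]))"
      unfolding exec_within_def by blast
    then show ?thesis using out by (intro exI[of _ t] exI[of _ "s4(0 := [aval (out n) s4])"]
          exI[of _ "aval (out n) s4"]) simp
  qed
  show ?thesis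
    unfolding poly_time_solvable_def using bound by blast
qed

definition square_exp :: "aexp \<Rightarrow> aexp" where
  "square_exp a = Mult a a"

lemma periodic_divisor_search:
  assumes "periodic_jrp_poly_time"
  shows "poly_time_solvable (\<lambda>m. [m]) (\<lambda>d. [d]) {m. 2 \<le> m} divisor_search"
\<comment> \<open>In \<open>es\<close> every second entry is a denominator, always 1 for integer
  coefficients.\<close>
proof (rule divisor_search_by_one_query[where f = periodic_instance
      and es = "\<lambda>n. [Top n, Const 1,
        Mult (Const 16) (square_exp (square_exp (Top n))), Const 1, Const 0, Const 1,
        Mult (Const 16) (square_exp (Top n)), Const 1, Const 1, Const 1]"
      and out = "\<lambda>n. Top 0"])
  show "poly_time_solvable encode_jrp encode_pair periodic_instances periodic_solution"
    using assms by (simp add: periodic_jrp_poly_time_def)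
next
  fix n m q1 q2 :: nat and s :: store
  assume "2 \<le> m" "periodic_solution (periodic_instance m) (q1, q2)" "top_of (s 0) = q2"
  then show "divisor_search m (aval (Top 0) s)"
    using periodic_instance_divisor by auto
next
  fix m :: nat assume "2 \<le> m"
  then show "periodic_instance m \<in> periodic_instances
      \<and> (\<exists>y. periodic_solution (periodic_instance m) y)"
    using periodic_instance_solvable[of m]
    by (auto simp: periodic_instances_def nonneg_jrp_def periodic_instance_def jrp_of_nats_def)
qed (auto simp: square_exp_def periodic_instance_def encode_jrp_of_nats eval_nat_numeral)

lemma aperiodic_divisor_search:
  assumes "aperiodic_jrp_poly_time"
  shows "poly_time_solvable (\<lambda>m. [m]) (\<lambda>d. [d]) {m. 2 \<le> m} divisor_search"
\<comment> \<open>Expressions cannot branch, so the case distinction in \<open>out\<close> is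
  arithmetic: \<open>parity\<close> is \<open>m mod 2\<close>, which selects
  \<open>m - 2 * q2\<close> for odd \<open>m\<close> and 2 for even \<open>m\<close>.\<close>
proof (rule divisor_search_by_one_query[where f = aperiodic_instance
      and es = "\<lambda>n. [square_exp (Top n), Const 1,
        Mult (Const 16) (square_exp (square_exp (Top n))), Const 1, square_exp (Top n), Const 1,
        Mult (Const 16) (square_exp (Top n)), Const 1, Const 4, Const 1]"
      and out = "\<lambda>n. let parity = Sub (Top n) (Mult (Const 2) (Div (Top n) (Const 2))) in
        Add (Mult parity (Sub (Top n) (Mult (Const 2) (Top 0))))
          (Sub (Const 2) (Mult (Const 2) parity))"])
  show "poly_time_solvable encode_jrp encode_pair aperiodic_instances aperiodic_solution"
    using assms by (simp add: aperiodic_jrp_poly_time_def)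
next
  fix n m q1 q2 :: nat and s :: store
  assume m: "2 \<le> m" and sol: "aperiodic_solution (aperiodic_instance m) (q1, q2)"
    and s: "top_of (s 0) = q2" "top_of (s n) = m"
  have "divisor_search m 2" if "even m"
    \<comment> \<open>For \<open>m = 2\<close> the answer 2 is no proper divisor, but 2 is prime and
      any answer counts.\<close>
    using that m by (cases "m = 2") (auto simp: divisor_search_def two_is_prime_nat)
  moreover have "divisor_search m (m - 2 * q2)" if "odd m"
    using aperiodic_instance_divisor[OF m that sol] .
  moreover have "m mod 2 * (m - 2 * q2) + (2 - 2 * (m mod 2)) = (if even m then 2 else m - 2 * q2)"
    by (simp add: odd_iff_mod_2_eq_one)
  ultimately have "divisor_search m (m mod 2 * (m - 2 * q2) + (2 - 2 * (m mod 2)))"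
    by simp
  then show "divisor_search m (aval (let parity = Sub (Top n) (Mult (Const 2) (Div (Top n) (Const 2))) in
        Add (Mult parity (Sub (Top n) (Mult (Const 2) (Top 0))))
          (Sub (Const 2) (Mult (Const 2) parity))) s)"
    by (simp add: Let_def s minus_mult_div_eq_mod)
next
  fix m :: nat assume "2 \<le> m"
  \<comment> \<open>Aperiodic instances require \<open>K0 \<le> K1\<close>;
    \<open>K0 \<le> K2\<close> holds with equality.\<close>
  then have "m ^ 2 \<le> m ^ 4" by (intro power_increasing) auto
  then have "m ^ 2 \<le> 16 * m ^ 4" by simp
  then have "(of_nat (m ^ 2) :: rat) \<le> of_nat (16 * m ^ 4)" by (simp only: of_nat_le_iff)
  with \<open>2 \<le> m\<close> show "aperiodic_instance m \<in> aperiodic_instances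
      \<and> (\<exists>y. aperiodic_solution (aperiodic_instance m) y)"
    using aperiodic_instance_solvable[of m]
    by (auto simp: aperiodic_instances_def nonneg_jrp_def aperiodic_instance_def jrp_of_nats_def)
qed (auto simp: square_exp_def aperiodic_instance_def encode_jrp_of_nats eval_nat_numeral Let_def)

section \<open>Factoring by repeated divisor search\<close>

text \<open>Removing \<open>m\<close> costs \<open>3 + bits m\<close>, test included, which is at
  most \<open>4 * bits m\<close>; the final failing test costs 2.\<close>

lemma exec_within_clear_stack:
  "exec_within (While (NonEmpty x) (Pop x)) s (4 * bits_list (s x) + 2) (s(x := []))"
proof (induction "s x" arbitrary: s)
  case Nil
  then have "s(x := []) = s" by (simp add: fun_upd_idem)
  then show ?case using exec_within_WhileFalse[of "NonEmpty x" s "Pop x"] Nil by simp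
next
  case (Cons m ms)
  let ?s = "s(x := ms)"
  have 1: "exec_within (Pop x) s (1 + bits m) ?s"
    by (rule exec_within_mono[OF exec_within_Pop]) (simp_all flip: Cons.hyps(2))
  have 2: "exec_within (While (NonEmpty x) (Pop x)) ?s (4 * bits_list ms + 2) (s(x := []))"
    using Cons.hyps(1)[of ?s] by simp
  have "aval (NonEmpty x) s \<noteq> 0" by (simp flip: Cons.hyps(2))
  from exec_within_WhileTrue[OF this 1 2] show ?case
    by (rule exec_within_mono) (use bits_pos[of m] in \<open>simp flip: Cons.hyps(2)\<close>)
qed

primrec clear_below :: "nat \<Rightarrow> com" where
  "clear_below 0 = Skip"
| "clear_below (Suc n) = Seq (clear_below n) (While (NonEmpty n) (Pop n))"

lemma exec_within_clear_below:
  assumes "\<And>x. x < n \<Longrightarrow> bits_list (s x) \<le> L"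
  shows "exec_within (clear_below n) s (1 + n * (4 * L + 2)) (override_on s (\<lambda>_. []) {..<n})"
  using assms
proof (induction n)
  case 0
  show ?case using exec_within_Skip by simp
next
  case (Suc n)
  let ?s = "override_on s (\<lambda>_. []) {..<n}"
  have 1: "exec_within (clear_below n) s (1 + n * (4 * L + 2)) ?s"
    using Suc by simp
  have "?s(n := []) = override_on s (\<lambda>_. []) {..<Suc n}"
    by (auto simp: override_on_def fun_eq_iff less_Suc_eq)
  then have "exec_within (While (NonEmpty n) (Pop n)) ?s (4 * bits_list (s n) + 2)
      (override_on s (\<lambda>_. []) {..<Suc n})"
    using exec_within_clear_stack[of n ?s] by simp
  from exec_within_Seq[OF 1 this] show ?case
    unfolding clear_below.simps using Suc.prems[of n] by (elim exec_within_mono) simp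
qed

lemma exec_within_move_stack:
  assumes "x \<noteq> y"
  shows "exec_within (While (NonEmpty y) (Seq (Push x (Top y)) (Pop y))) s
    (6 * bits_list (s y) + 2) (s(x := rev (s y) @ s x, y := []))"
proof (induction "s y" arbitrary: s)
  case Nil
  then have "s(x := rev (s y) @ s x, y := []) = s" by (simp add: fun_upd_idem)
  then show ?case
    using exec_within_WhileFalse[of "NonEmpty y" s "Seq (Push x (Top y)) (Pop y)"] Nil by simp
next
  case (Cons m ms)
  let ?s1 = "s(x := m # s x)" and ?s = "s(x := m # s x, y := ms)"
  have "exec_within (Push x (Top y)) s (1 + bits m) ?s1"
    by (rule exec_within_mono[OF exec_within_Push]) (simp_all flip: Cons.hyps(2))
  moreover have "exec_within (Pop y) ?s1 (1 + bits m) ?s"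
    using assms by (intro exec_within_mono[OF exec_within_Pop]) (simp_all flip: Cons.hyps(2))
  ultimately have 1: "exec_within (Seq (Push x (Top y)) (Pop y)) s (1 + bits m + (1 + bits m)) ?s"
    by (rule exec_within_Seq)
  have 2: "exec_within (While (NonEmpty y) (Seq (Push x (Top y)) (Pop y))) ?s
      (6 * bits_list ms + 2) (s(x := rev (s y) @ s x, y := []))"
    using Cons.hyps(1)[of ?s] assms by (simp add: fun_upd_twist flip: Cons.hyps(2))
  have "aval (NonEmpty y) s \<noteq> 0" by (simp flip: Cons.hyps(2))
  from exec_within_WhileTrue[OF this 1 2] show ?case
    by (rule exec_within_mono) (use bits_pos[of m] in \<open>simp flip: Cons.hyps(2)\<close>)
qed

text \<open>Every prime factor is at least 2, so a number with \<open>k\<close> of them is at least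
  \<open>2 ^ k\<close>.\<close>

lemma size_prime_factorization_le_bits:
  assumes "0 < n"
  shows "size (prime_factorization n) \<le> bits n"
proof -
  have pow: "2 ^ size A \<le> \<Prod>\<^sub># A" if "\<And>p. p \<in># A \<Longrightarrow> 2 \<le> p" for A :: "nat multiset"
    using that by (induction A) (auto intro!: mult_le_mono)
  have "2 ^ size (prime_factorization n) \<le> \<Prod>\<^sub># (prime_factorization n)"
    by (rule pow) (simp add: in_prime_factors_iff prime_ge_2_nat)
  also have "\<dots> = n" using assms by (simp add: prod_mset_prime_factorization_nat)
  also have "n < 2 ^ (bits n - 1)" by (rule less_two_power_bits)
  finally have "size (prime_factorization n) < bits n - 1" by simp
  then show ?thesis by simp
qed

lemma size_prime_factorization_pos:
  assumes "1 < (n :: nat)"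
  shows "0 < size (prime_factorization n)"
proof -
  obtain p where "prime p" "p dvd n" using assms prime_factor_nat by (metis less_not_refl)
  then have "p \<in># prime_factorization n" using assms by (auto simp: in_prime_factors_iff)
  then show ?thesis by (auto simp: nonempty_has_size[symmetric])
qed

text \<open>Iterations left for the work list: a number with \<open>k\<close> prime factors is the root of a binary tree
  with \<open>k\<close> leaves, hence with \<open>2 k - 1\<close> nodes.\<close>

definition pending :: "nat list \<Rightarrow> nat" where
  "pending ws = (\<Sum>m\<leftarrow>ws. 2 * size (prime_factorization m) - 1)"

lemma pending_Cons: "pending (m # ws) = 2 * size (prime_factorization m) - 1 + pending ws"
  by (simp add: pending_def)

text \<open>With \<open>i\<close> and \<open>j\<close> prime factors, \<open>2 (i + j) - 1\<close>
  exceeds \<open>(2 i - 1) + (2 j - 1)\<close> by one. Since \<open>i\<close> and \<open>j\<close>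
  are positive, truncated subtraction is harmless.\<close>

lemma pending_split:
  assumes "1 < a" "1 < b"
  shows "Suc (pending (a # b # ws)) = pending (a * b # ws)"
  using assms size_prime_factorization_pos[of a] size_prime_factorization_pos[of b]
  by (simp add: pending_Cons prime_factorization_mult)

definition factor_list :: "nat list \<Rightarrow> nat multiset" where
  "factor_list ws = (\<Sum>m\<leftarrow>ws. prime_factorization m)"

lemma factor_list_Cons [simp]: "factor_list (m # ws) = prime_factorization m + factor_list ws"
  by (simp add: factor_list_def)

text \<open>The store between two iterations: numbers still to be split on stack \<open>n\<close>,
  primes found on \<open>Suc n\<close>. The stacks below \<open>n\<close> belong to the oracle, and
  \<open>n + 2\<close> holds its answer during an iteration.\<close>

definition work_store :: "nat \<Rightarrow> nat list \<Rightarrow> nat list \<Rightarrow> store" where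
  "work_store n ws os = (\<lambda>_. [])(n := ws, Suc n := os)"

lemma factorization_of_divisor_search:
  assumes "poly_time_solvable (\<lambda>m. [m]) (\<lambda>d. [d]) {m. 2 \<le> m} divisor_search"
  shows factorization_poly_time
proof -
  have solvable: "\<exists>d. divisor_search m d" if "2 \<le> m" for m
    using nontrivial_divisorE[OF that] unfolding divisor_search_def
    by (metis dvd_triv_left mult.right_neutral nat_mult_less_cancel1 order_less_trans zero_less_one)
  from assms obtain c p where c: "\<And>m. 2 \<le> m \<Longrightarrow>
      \<exists>t s d. exec c (init_store [m]) t s \<and> t \<le> poly p (bits m) \<and> s 0 = [d] \<and> divisor_search m d"
    unfolding poly_time_solvable_def using solvable by fastforce

  \<comment> \<open>The factoring program\<close>
  obtain n where n: "cvars c \<subseteq> {..<n}" "0 < n" by (rule obtain_fresh)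
  \<comment> \<open>A product serves as conjunction. For an answer \<open>d\<close>, the factors are
    nonzero iff \<open>d > 1\<close>, \<open>d < m\<close> and \<open>m mod d = 0\<close>.\<close>
  define guard where "guard = Mult
      (Mult (Sub (Top (n + 2)) (Const 1)) (Sub (Top n) (Top (n + 2))))
      (Sub (Const 1) (Sub (Top n) (Mult (Top (n + 2)) (Div (Top n) (Top (n + 2))))))"
  define branch where "branch = If guard
      (Seq (Assign n (Div (Top n) (Top (n + 2)))) (Push n (Top (n + 2))))
      (Seq (Push (Suc n) (Top n)) (Pop n))"
  define body where "body = Seq (Push 0 (Top n)) (Seq c (Seq (Push (n + 2) (Top 0))
      (Seq (clear_below n) (Seq branch (Pop (n + 2))))))"
  \<comment> \<open>The initial test keeps \<open>M = 1\<close> off the work list, whose entries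
    must be at least 2. The last loop delivers the primes in reversed order, which leaves their
    multiset unchanged.\<close>
  define prog where "prog = Seq (If (Sub (Top 0) (Const 1)) (Push n (Top 0)) Skip) (Seq (Pop 0)
      (Seq (While (NonEmpty n) body) (While (NonEmpty (Suc n)) (Seq (Push 0 (Top (Suc n))) (Pop (Suc n))))))"
  have guard: "aval guard s \<noteq> 0 \<longleftrightarrow> 1 < d \<and> d < m \<and> d dvd m"
    if "top_of (s n) = m" "top_of (s (n + 2)) = d" for s m d
  proof -
    have "m - d * (m div d) = m mod d" by (simp add: minus_mult_div_eq_mod)
    then show ?thesis using that by (auto simp: guard_def dvd_eq_mod_eq_0)
  qed
  obtain k where k: "\<And>s B. 1 \<le> B \<Longrightarrow> \<forall>x\<in>avars guard. bits (top_of (s x)) \<le> B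
      \<Longrightarrow> acost guard s \<le> k * B"
    using acost_linear[of guard] by metis
  \<comment> \<open>By \<open>exec_stack_size\<close>, \<open>w\<close> bounds each stack the oracle
    leaves behind; \<open>T\<close> bounds one iteration, with the term \<open>4 * n\<close> paying
    for the clearing of \<open>n\<close> stacks.\<close>
  define w where "w = [:0, 1:] + smult 2 p"
  define T where "T = [:7 + 2 * n:] + [:0, 1:] + p + smult (4 * n + k + 8) w"

  \<comment> \<open>One iteration: splitting a number or recording a prime\<close>
  have step: "\<exists>ws' os'. exec_within body (work_store n (m # ws) os) (poly T B) (work_store n ws' os')
      \<and> (prime m \<and> ws' = ws \<and> os' = m # os
        \<or> (\<exists>a b. m = a * b \<and> 1 < a \<and> 1 < b \<and> ws' = a # b # ws \<and> os' = os))"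
    if m: "2 \<le> m" and B: "bits m \<le> B" for m ws os B
  proof -
    let ?W = "poly w B"
    define s0 where "s0 = work_store n (m # ws) os"
    define s1 where "s1 = s0(0 := [m])"
    obtain t s d where run: "exec c (init_store [m]) t s" and t: "t \<le> poly p (bits m)"
      and s: "s 0 = [d]" and d: "divisor_search m d"
      using c[OF m] by blast
    define s2 where "s2 = override_on s1 s {..<n}"
    define s3 where "s3 = s2(n + 2 := [d])"
    define s4 where "s4 = s0(n + 2 := [d])"
    have t': "t \<le> poly p B" using t poly_nat_mono[OF B, of p] by simp
    have size: "bits_list (s x) \<le> ?W" for x
    proof -
      have "bits_list (init_store [m] x) \<le> B" using B by (simp add: init_store_def)
      then show ?thesis using exec_stack_size[OF run, of x] t' by (simp add: w_def)
    qed
    have dW: "bits d \<le> ?W" using size[of 0] by (simp add: s)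
    have mW: "bits m \<le> ?W" using B by (simp add: w_def)
    have e1: "exec_within (Push 0 (Top n)) s0 (1 + B) s1"
      using n B by (intro exec_within_mono[OF exec_within_Push])
        (auto simp: s1_def s0_def work_store_def)
    have e2: "exec_within c s1 (poly p B) s2"
      unfolding s2_def using n
      by (intro exec_within_frame[OF run t']) (auto simp: s1_def s0_def work_store_def)
    have e3: "exec_within (Push (n + 2) (Top 0)) s2 (1 + ?W) s3"
      using n dW by (intro exec_within_mono[OF exec_within_Push])
        (auto simp: s3_def s2_def s1_def s0_def s work_store_def)
    have "override_on s3 (\<lambda>_. []) {..<n} = s4"
      using n by (auto simp: override_on_def s4_def s3_def s2_def s1_def s0_def work_store_def)
    then have e4: "exec_within (clear_below n) s3 (1 + n * (4 * ?W + 2)) s4"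
      using exec_within_clear_below[of n s3 ?W] size by (simp add: s3_def s2_def)
    have s4: "s4 n = m # ws" "s4 (Suc n) = os" "s4 (n + 2) = [d]" "s4 (Suc (Suc n)) = [d]"
      by (auto simp: s4_def s0_def work_store_def)
    have guard_cost: "acost guard s4 \<le> k * ?W"
      using s4 dW mW bits_pos[of m] by (intro k) (auto simp: guard_def)
    \<comment> \<open>The allowance \<open>2 + 6 * ?W\<close> is the cost of splitting; recording a
      prime is cheaper and is rounded up to it.\<close>
    have combine: "exec_within body s0 (poly T B) s6"
      if "exec_within branch s4 (1 + acost guard s4 + (2 + 6 * ?W)) s5"
        "s5 (n + 2) = [d]" "s6 = s5(n + 2 := [])" for s5 s6
    proof -
      have e6: "exec_within (Pop (n + 2)) s5 (1 + ?W) s6"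
        using that(2,3) dW by (intro exec_within_mono[OF exec_within_Pop]) auto
      have "exec_within body s0 (1 + B + (poly p B + (1 + ?W + (1 + n * (4 * ?W + 2)
          + (1 + acost guard s4 + (2 + 6 * ?W) + (1 + ?W)))))) s6"
        unfolding body_def by (intro exec_within_Seq[OF e1] exec_within_Seq[OF e2]
          exec_within_Seq[OF e3] exec_within_Seq[OF e4] exec_within_Seq[OF that(1)] e6)
      then show ?thesis
        by (rule exec_within_mono) (use guard_cost in \<open>simp add: T_def algebra_simps\<close>)
    qed
    show ?thesis
    proof (cases "1 < d \<and> d < m \<and> d dvd m")
      case True
      then obtain b where b: "m = d * b" by auto
      with True have "1 < b" by (cases b) auto
      have "m div d = b" using True b by simp
      let ?s = "s4(n := b # ws)" and ?s5 = "s4(n := d # b # ws)"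
      have f1: "exec_within (Assign n (Div (Top n) (Top (n + 2)))) s4 (1 + 5 * ?W) ?s"
        using dW mW \<open>m div d = b\<close>
        by (intro exec_within_mono[OF exec_within_Assign]) (auto simp: s4)
      have f2: "exec_within (Push n (Top (n + 2))) ?s (1 + ?W) ?s5"
        using dW s4 by (intro exec_within_mono[OF exec_within_Push]) auto
      have "aval guard s4 \<noteq> 0" using guard[of s4 m d] s4 True by simp
      from exec_within_IfTrue[OF this exec_within_Seq[OF f1 f2]]
      have "exec_within branch s4 (1 + acost guard s4 + (2 + 6 * ?W)) ?s5"
        unfolding branch_def by (rule exec_within_mono) simp
      then have "exec_within body s0 (poly T B) (?s5(n + 2 := []))"
        by (rule combine) (simp_all add: s4)
      moreover have "?s5(n + 2 := []) = work_store n (d # b # ws) os"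
        by (auto simp: s4_def s0_def work_store_def)
      ultimately show ?thesis
        using b True \<open>1 < b\<close> unfolding s0_def by metis
    next
      case False
      \<comment> \<open>The oracle answer is correct, so it can fail the trial division only when
        \<open>m\<close> is prime.\<close>
      then have prime: "prime m" using d by (auto simp: divisor_search_def)
      let ?s = "s4(Suc n := m # os)" and ?s5 = "s4(Suc n := m # os, n := ws)"
      have f1: "exec_within (Push (Suc n) (Top n)) s4 (1 + ?W) ?s"
        using mW by (intro exec_within_mono[OF exec_within_Push]) (auto simp: s4)
      have f2: "exec_within (Pop n) ?s (1 + ?W) ?s5"
        using mW by (intro exec_within_mono[OF exec_within_Pop]) (auto simp: s4)
      have "aval guard s4 = 0" using guard[of s4 m d] s4 False by auto
      from exec_within_IfFalse[OF this exec_within_Seq[OF f1 f2]]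
      have "exec_within branch s4 (1 + acost guard s4 + (2 + 6 * ?W)) ?s5"
        unfolding branch_def by (rule exec_within_mono) simp
      then have "exec_within body s0 (poly T B) (?s5(n + 2 := []))"
        by (rule combine) (simp_all add: s4)
      moreover have "?s5(n + 2 := []) = work_store n ws (m # os)"
        by (auto simp: s4_def s0_def work_store_def)
      ultimately show ?thesis using prime unfolding s0_def by metis
    qed
  qed

  \<comment> \<open>The main loop\<close>
  have loop: "\<exists>os'. exec_within (While (NonEmpty n) body) (work_store n ws os)
        (pending ws * (2 + poly T B) + 2) (work_store n [] os')
      \<and> mset os' = mset os + factor_list ws"
    if "\<And>m. m \<in> set ws \<Longrightarrow> 2 \<le> m \<and> bits m \<le> B" for ws os B
    using that
  proof (induction "pending ws" arbitrary: ws os rule: less_induct)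
    case less
    show ?case
    proof (cases ws)
      case Nil
      have "aval (NonEmpty n) (work_store n [] os) = 0" by (simp add: work_store_def)
      from exec_within_WhileFalse[OF this] show ?thesis
        by (auto simp: Nil factor_list_def pending_def)
    next
      case (Cons m ws0)
      with less.prems have m: "2 \<le> m" "bits m \<le> B" by auto
      have ne: "aval (NonEmpty n) (work_store n (m # ws0) os) \<noteq> 0"
        by (simp add: work_store_def)
      obtain ws' os' where e1: "exec_within body (work_store n (m # ws0) os) (poly T B) (work_store n ws' os')"
        and split: "prime m \<and> ws' = ws0 \<and> os' = m # os
          \<or> (\<exists>a b. m = a * b \<and> 1 < a \<and> 1 < b \<and> ws' = a # b # ws0 \<and> os' = os)"
        using step[OF m] by blast
      \<comment> \<open>Every iteration lowers \<open>pending\<close> by exactly one, keeps the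
        prime factors in total, and preserves the length bound \<open>B\<close> because factors of
        \<open>m\<close> are no larger than \<open>m\<close>.\<close>
      have inv: "Suc (pending ws') = pending ws \<and> (\<forall>x\<in>set ws'. 2 \<le> x \<and> bits x \<le> B)
          \<and> mset os' + factor_list ws' = mset os + factor_list ws"
        using split
      proof (elim disjE exE conjE)
        assume "prime m" "ws' = ws0" "os' = m # os"
        then show ?thesis using less.prems Cons
          by (auto simp: pending_Cons prime_factorization_prime)
      next
        fix a b assume ab: "m = a * b" "1 < a" "1 < b" "ws' = a # b # ws0" "os' = os"
        then have "a \<le> m" "b \<le> m" by simp_all
        then have "bits a \<le> B" "bits b \<le> B" using m(2) bits_mono order.trans by blast+
        moreover have "Suc (pending ws') = pending ws"
          using pending_split[OF ab(2,3), of ws0] by (simp only: ab(1,4) Cons)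
        ultimately show ?thesis using ab less.prems Cons
          by (auto simp: prime_factorization_mult)
      qed
      then obtain os'' where e2: "exec_within (While (NonEmpty n) body) (work_store n ws' os')
          (pending ws' * (2 + poly T B) + 2) (work_store n [] os'')"
        and os'': "mset os'' = mset os' + factor_list ws'"
        using less.hyps[of ws' os'] by auto
      have "1 + acost (NonEmpty n) (work_store n (m # ws0) os) + poly T B
          + (pending ws' * (2 + poly T B) + 2) \<le> Suc (pending ws') * (2 + poly T B) + 2"
        by simp
      from exec_within_mono[OF exec_within_WhileTrue[OF ne e1 e2] this] os'' inv Cons
      show ?thesis by auto
    qed
  qed

  \<comment> \<open>Total running time and output\<close>
  define P where "P = [:11:] + [:0, 4:] + [:0, 2:] * ([:2:] + T) + [:0, 6:] * [:0, 1:]"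
  have "\<exists>t s ps. exec prog (init_store [M]) t s \<and> t \<le> poly P (bits_list [M])
      \<and> s 0 = ps \<and> mset ps = prime_factorization M" if M: "0 < M" for M
  proof -
    let ?B = "bits M"
    define ws where "ws = (if M = 1 then [] else [M])"
    define s1 where "s1 = (init_store [M])(n := ws)"
    have e1: "exec_within (If (Sub (Top 0) (Const 1)) (Push n (Top 0)) Skip) (init_store [M])
        (1 + (2 * ?B + 2 * bits 1) + (1 + ?B)) s1"
    proof (cases "M = 1")
      case True
      then have "s1 = init_store [M]"
        using n by (auto simp: s1_def ws_def init_store_def)
      then have skip: "exec_within Skip (init_store [M]) (1 + ?B) s1"
        using exec_within_mono[OF exec_within_Skip] by simp
      have "aval (Sub (Top 0) (Const 1)) (init_store [M]) = 0"
        using True by (simp add: init_store_def)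
      from exec_within_IfFalse[OF this skip] show ?thesis
        by (rule exec_within_mono) (simp add: init_store_def)
    next
      case False
      have push: "exec_within (Push n (Top 0)) (init_store [M]) (1 + ?B) s1"
        using n False by (intro exec_within_mono[OF exec_within_Push])
          (auto simp: s1_def ws_def init_store_def)
      have "aval (Sub (Top 0) (Const 1)) (init_store [M]) \<noteq> 0"
        using False M by (simp add: init_store_def)
      from exec_within_IfTrue[OF this push] show ?thesis
        by (rule exec_within_mono) (simp add: init_store_def)
    qed
    have e2: "exec_within (Pop 0) s1 (1 + ?B) (work_store n ws [])"
      using n by (intro exec_within_mono[OF exec_within_Pop])
        (auto simp: s1_def work_store_def init_store_def)
    have ws: "2 \<le> m \<and> bits m \<le> ?B" if "m \<in> set ws" for m
      using that M by (auto simp: ws_def split: if_splits)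
    have "factor_list ws = prime_factorization M"
      by (simp add: ws_def factor_list_def)
    with loop[of ws ?B "[]"] ws obtain os
      where e3: "exec_within (While (NonEmpty n) body) (work_store n ws [])
        (pending ws * (2 + poly T ?B) + 2) (work_store n [] os)"
      and os: "mset os = prime_factorization M" by auto
    have e4: "exec_within (While (NonEmpty (Suc n)) (Seq (Push 0 (Top (Suc n))) (Pop (Suc n))))
        (work_store n [] os) (6 * bits_list os + 2)
        ((work_store n [] os)(0 := rev os, Suc n := []))"
      using exec_within_move_stack[of 0 "Suc n" "work_store n [] os"] n
      by (simp add: work_store_def)
    have \<Omega>: "size (prime_factorization M) \<le> ?B"
      by (rule size_prime_factorization_le_bits[OF M])
    then have pending: "pending ws \<le> 2 * ?B" by (auto simp: ws_def pending_def)
    have "bits x \<le> ?B" if "x \<in> set os" for x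
    proof -
      have "x \<in># prime_factorization M" using that by (simp flip: os)
      then have "x \<le> M" using M by (auto intro: dvd_imp_le)
      then show ?thesis by (rule bits_mono)
    qed
    then have "bits_list os \<le> length os * ?B"
      unfolding bits_list_def by (induction os) (auto intro: add_mono)
    also have "length os = size (prime_factorization M)" by (simp flip: os)
    also have "\<dots> * ?B \<le> ?B * ?B" using \<Omega> by simp
    finally have os_bits: "bits_list os \<le> ?B * ?B" .
    have "bits 1 \<le> 2" using bits_le_iff[of 1 1] by simp
    moreover have "pending ws * (2 + poly T ?B) \<le> 2 * ?B * (2 + poly T ?B)"
      by (rule mult_le_mono1[OF pending])
    \<comment> \<open>In \<open>P\<close>, the constant 11 and the term \<open>4 * ?B\<close> cover
      the overhead outside the loops; the loops account for at most \<open>2 * ?B\<close> iterations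
      of cost \<open>2 + poly T ?B\<close> and for moving an output of length at most
      \<open>?B * ?B\<close>.\<close>
    ultimately have bound: "1 + (2 * ?B + 2 * bits 1) + (1 + ?B) + (1 + ?B
        + (pending ws * (2 + poly T ?B) + 2 + (6 * bits_list os + 2))) \<le> poly P (bits_list [M])"
      using os_bits by (simp add: P_def algebra_simps)
    have "exec_within prog (init_store [M]) (poly P (bits_list [M]))
        ((work_store n [] os)(0 := rev os, Suc n := []))"
      unfolding prog_def
      by (rule exec_within_mono[OF exec_within_Seq[OF e1 exec_within_Seq[OF e2
          exec_within_Seq[OF e3 e4]]] bound])
    then obtain t where "t \<le> poly P (bits_list [M])"
      "exec prog (init_store [M]) t ((work_store n [] os)(0 := rev os, Suc n := []))"
      unfolding exec_within_def by blast
    then show ?thesis using os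
      by (intro exI[of _ t] exI[of _ "(work_store n [] os)(0 := rev os, Suc n := [])"]
        exI[of _ "rev os"]) simp
  qed
  then show ?thesis
    unfolding factorization_poly_time_def poly_time_solvable_def by blast
qed

theorem theorem1:
  "(aperiodic_jrp_poly_time \<longrightarrow> factorization_poly_time)
   \<and> (periodic_jrp_poly_time \<longrightarrow> factorization_poly_time)"
  using aperiodic_divisor_search periodic_divisor_search factorization_of_divisor_search by blast

end
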